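(* Let $m\ge 2$ be a positive integer. There exists a nonabelian group $\mathcal{G}$ that, for each positive integer $r$ with $1\le r<m$, contains a $(v,k,\lambda,\mu)$-partial difference set with $$v=2^{3m},$$ $$k=(2^{m+r}-2^m+2^r)(2^m-1),$$ $$\lambda=2^m-2^r+(2^{m+r}-2^m+2^r)(2^r-2),$$ $$\mu=(2^{m+r}-2^m+2^r)(2^r-1).$$
   Context: A subset $D$ of a finite group $G$ is a $(v,k,\lambda,\mu)$-partial difference set if $|G|=v$, $|D|=k$, every nonidentity $g\in D$ can be expressed as $d_1d_2^{-1}$ with $d_1,d_2\in D$ in exactly $\lambda$ ways, and every $g\in G\setminus(D\cup\{1\})$ can be so expressed in exactly $\mu$ ways. The displayed parameters are called Denniston parameters. *)

theory Defs
  imports "HOL-Algebra.Group" "HOL-Algebra.Coset"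
begin

text \<open>Representations \<open>g = d1 d2\<^sup>-\<^sup>1\<close> are counted as ordered pairs \<open>(d1, d2)\<close>.  As in the
  source definition, the subset may contain the identity and need not be closed under inverses.\<close>

definition partial_difference_set ::
    "('a, 'b) monoid_scheme \<Rightarrow> 'a set \<Rightarrow> nat \<Rightarrow> nat \<Rightarrow> nat \<Rightarrow> nat \<Rightarrow> bool" where
  "partial_difference_set G D v k l u \<longleftrightarrow>
     group G \<and> finite (carrier G) \<and> D \<subseteq> carrier G \<and> order G = v \<and> card D = k \<and>
     (\<forall>g \<in> D - {\<one>\<^bsub>G\<^esub>}.
        card {(d1, d2). d1 \<in> D \<and> d2 \<in> D \<and> g = d1 \<otimes>\<^bsub>G\<^esub> inv\<^bsub>G\<^esub> d2} = l) \<and>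
     (\<forall>g \<in> carrier G - (D \<union> {\<one>\<^bsub>G\<^esub>}).
        card {(d1, d2). d1 \<in> D \<and> d2 \<in> D \<and> g = d1 \<otimes>\<^bsub>G\<^esub> inv\<^bsub>G\<^esub> d2} = u)"

end

theory Submission
  imports Defs "HOL-Algebra.Algebraic_Closure_Type" "HOL-Library.Z2"
begin

text \<open>Let \<open>q = 2 ^ m\<close>, \<open>n = 2 ^ r\<close>, let \<open>F\<close> be the field with \<open>q\<close> elements and let
  \<open>Q(x, y) = x\<^sup>2 + x y + \<beta> y\<^sup>2\<close> be an anisotropic form over \<open>F\<close>. For an additive subgroup \<open>A\<close> of \<open>F\<close>
  with \<open>n\<close> elements, the set \<open>K\<close> of points of the affine plane \<open>F\<^sup>2\<close> at which \<open>Q\<close> takes a value in \<open>A\<close>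
  is Denniston's maximal arc: a line that meets \<open>K\<close> meets it in exactly \<open>n\<close> points
  (\<open>line_meets_K\<close>). On a line the form is, up to its value at a point of \<open>K\<close>, an additive map
  \<open>t \<mapsto> t T + t\<^sup>2 N\<close>. If \<open>T = 0\<close> it is bijective. Otherwise it is two-to-one onto a subgroup of index
  two, and \<open>A\<close> is not contained in this subgroup because \<open>Q\<close> has no nontrivial zero; so the subgroup
  contains half of \<open>A\<close>, and the preimage of that half has \<open>n\<close> elements again.

  Let \<open>D\<close> consist of the nonzero vectors of \<open>F\<^sup>3\<close> on the lines spanned by \<open>(1, \<kappa>)\<close> with \<open>\<kappa> \<in> K\<close>. For a
  nonzero \<open>g\<close>, the number of \<open>d \<in> D\<close> with \<open>g + d \<in> D\<close> is found one direction \<open>\<kappa>\<close> at a time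
  (\<open>card_translate\<close>). If \<open>g\<close> is a multiple of \<open>(1, \<kappa>)\<close>, all but two multiples of \<open>(1, \<kappa>)\<close> count. If not,
  \<open>g\<close> and \<open>(1, \<kappa>)\<close> span a plane, which is a line through \<open>\<kappa>\<close> in the projective picture and
  has \<open>n - 1\<close> further points of the arc; each of them gives one \<open>d\<close>, except that \<open>d = 0\<close> has to be
  discarded when \<open>g \<in> D\<close>. Summing over \<open>K\<close> gives the Denniston parameters.

  The abelian group \<open>F\<^sup>3\<close> can now be replaced by a nonabelian one. The involution
  \<open>(x, y) \<mapsto> (x + y, y)\<close> preserves \<open>Q\<close>, hence \<open>D\<close>. Let \<open>F\<close> act on \<open>F\<^sup>2\<close> through a nontrivial homomorphism
  onto the group generated by this involution. In the semidirect product,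
  left translation by \<open>g\<close> differs from the translation of \<open>F\<^sup>3\<close> by a map that permutes \<open>D\<close>,
  so the numbers of representations do not change (\<open>card_twisted_translate\<close>). The group
  depends only on \<open>m\<close>, so it serves all \<open>r\<close> at once.\<close>

section \<open>Finite fields of characteristic two\<close>

text \<open>
  The field is a subset of a larger type, because types cannot depend on the
  variable \<open>m\<close>. Rules such as \<open>cancel_left\<close> come from \<open>- x = x\<close>.
\<close>

locale binary_subfield =
  fixes F :: "'a :: field set"
  assumes finite_F: "finite F"
    and one_F: "1 \<in> F"
    and add_F: "x \<in> F \<Longrightarrow> y \<in> F \<Longrightarrow> x + y \<in> F"
    and mult_F: "x \<in> F \<Longrightarrow> y \<in> F \<Longrightarrow> x * y \<in> F"
    and inverse_F: "x \<in> F \<Longrightarrow> inverse x \<in> F"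
    and double: "x + x = (0 :: 'a)"
begin

lemma zero_F: "0 \<in> F"
  using add_F[OF one_F one_F] by (simp add: double)

lemma divide_F: "x \<in> F \<Longrightarrow> y \<in> F \<Longrightarrow> x / y \<in> F"
  by (simp add: divide_inverse mult_F inverse_F)

lemma square_F: "x \<in> F \<Longrightarrow> x\<^sup>2 \<in> F"
  by (simp add: power2_eq_square mult_F)

lemmas closed_F = zero_F one_F add_F mult_F inverse_F divide_F square_F

lemma two_eq_zero: "(2 :: 'a) = 0"
  using double[of 1] by simp

lemma cancel_left: "x + (x + y) = (y :: 'a)"
  by (metis add.assoc double add_0)

lemma cancel_right: "(x + y) + y = (x :: 'a)"
  by (metis add.assoc double add_0_right)

lemma eq_iff_sum_zero: "x + y = 0 \<longleftrightarrow> x = (y :: 'a)"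
  by (metis cancel_right double add_0)

lemma square_add: "(x + y)\<^sup>2 = x\<^sup>2 + (y :: 'a)\<^sup>2"
proof -
  have "(x + y)\<^sup>2 = x\<^sup>2 + y\<^sup>2 + (x * y + x * y)"
    by (simp add: power2_eq_square algebra_simps)
  then show ?thesis by (simp add: double)
qed

end

lemma double_zero_alg_closure: "x + x = (0 :: bit alg_closure)"
proof -
  have "(1::bit alg_closure) + 1 = to_ac (1 + 1)"
    by (simp only: to_ac_add to_ac_1)
  then have "(1::bit alg_closure) + 1 = 0" by simp
  then have "x * (1 + 1) = 0" by simp
  then show ?thesis by (simp add: algebra_simps)
qed

lemma power_two_power_add:
  fixes x y :: "'a :: comm_ring_1"
  assumes double: "\<And>x :: 'a. x + x = 0"
  shows "(x + y) ^ (2 ^ m) = x ^ (2 ^ m) + y ^ (2 ^ m)"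
proof (induction m)
  case (Suc m)
  have "(x + y) ^ (2 ^ Suc m) = ((x + y) ^ (2 ^ m))\<^sup>2"
    by (simp add: power_mult mult.commute flip: power_mult)
  also have "\<dots> = (x ^ 2 ^ m)\<^sup>2 + (y ^ 2 ^ m)\<^sup>2 + (x ^ 2 ^ m * y ^ 2 ^ m + x ^ 2 ^ m * y ^ 2 ^ m)"
    unfolding Suc by (simp add: power2_eq_square algebra_simps)
  also have "\<dots> = x ^ (2 ^ Suc m) + y ^ (2 ^ Suc m)"
    by (simp add: double mult.commute flip: power_mult)
  finally show ?case .
qed simp

text \<open>A double root of \<open>p\<close> would be a common root of \<open>p\<close> and its derivative, so the linear factors of \<open>p\<close>
  are pairwise distinct. The argument works in every characteristic.\<close>

lemma card_roots_coprime_pderiv: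
  fixes p :: "'a :: alg_closed_field poly"
  assumes "p \<noteq> 0" and simple: "\<And>a. poly p a = 0 \<Longrightarrow> poly (pderiv p) a \<noteq> 0"
  shows "card {x. poly p x = 0} = degree p"
proof -
  obtain M where M: "size M = degree p" "p = smult (lead_coeff p) (\<Prod>x\<in>#M. [:-x, 1:])"
    using alg_closed_imp_factorization[OF assms(1)] by blast
  have roots: "{x. poly p x = 0} = set_mset M"
  proof -
    have "poly p x = 0 \<longleftrightarrow> x \<in># M" for x
      using assms(1) by (subst M(2)) (auto simp: poly_prod_mset prod_mset_zero_iff)
    then show ?thesis by auto
  qed
  have "count M a \<le> 1" for a
  proof (rule ccontr)
    assume "\<not> count M a \<le> 1"
    then have "a \<in># M" "a \<in># M - {#a#}"
      by (auto simp: not_le simp flip: count_greater_zero_iff)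
    then obtain N where "M = add_mset a (add_mset a N)"
      by (metis insert_DiffM)
    then have "p = [:-a, 1:] * ([:-a, 1:] * smult (lead_coeff p) (\<Prod>x\<in>#N. [:-x, 1:]))"
      using M(2) by (simp only: image_mset_add_mset prod_mset.add_mset mult_smult_right)
    then obtain s where s: "p = [:-a, 1:] * ([:-a, 1:] * s)" by blast
    have "poly p a = 0" "poly (pderiv p) a = 0"
      by (subst s, simp add: pderiv_mult del: mult_pCons_left)+
    then show False using simple by blast
  qed
  then have "M = mset_set (set_mset M)"
    by (intro multiset_eqI) (metis count_mset_set(1,3) count_eq_zero_iff finite_set_mset
        le_antisym less_one not_less)
  then have "size M = card (set_mset M)"
    by (metis size_mset_set)
  then show ?thesis using roots M(1) by simp
qed

text \<open>The fixed points of the automorphism \<open>x \<mapsto> x ^ (2 ^ m)\<close> of the algebraic closure of the prime field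
  form a subfield. They are the roots of \<open>X ^ (2 ^ m) + X\<close>, whose derivative is \<open>1\<close>.\<close>

lemma exists_binary_subfield:
  assumes "m > 0"
  shows "\<exists>F :: bit alg_closure set. binary_subfield F \<and> card F = 2 ^ m"
proof -
  let ?p = "monom 1 (2 ^ m) + monom 1 1 :: bit alg_closure poly"
  define F where "F = {x :: bit alg_closure. x ^ (2 ^ m) = x}"
  have eq: "x + y = 0 \<longleftrightarrow> x = y" for x y :: "bit alg_closure"
    by (metis add_left_cancel double_zero_alg_closure)
  have gt: "(1::nat) < 2 ^ m" using one_less_power[of "2::nat" m] assms by simp
  have deg: "degree ?p = 2 ^ m"
    by (subst degree_add_eq_left) (use gt in \<open>simp_all add: degree_monom_eq\<close>)
  have nz: "?p \<noteq> 0" using deg gt by auto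
  have F: "F = {x. poly ?p x = 0}"
    by (auto simp: F_def poly_monom eq)
  have "of_nat (2 ^ m) = (0 :: bit alg_closure)"
    using assms double_zero_alg_closure[of 1] by (cases m) auto
  then have "pderiv ?p = 1"
    by (simp add: pderiv_add pderiv_monom)
  then have "card F = 2 ^ m"
    unfolding F using card_roots_coprime_pderiv[OF nz] deg by simp
  moreover have "finite F"
    unfolding F using nz by (rule poly_roots_finite)
  then have "binary_subfield F"
    by unfold_locales
      (auto simp: F_def power_two_power_add double_zero_alg_closure power_mult_distrib power_inverse)
  ultimately show ?thesis by blast
qed

section \<open>Additive subgroups\<close>

context binary_subfield begin

definition additive_subgroup :: "'a set \<Rightarrow> bool" where
  "additive_subgroup A \<longleftrightarrow> A \<subseteq> F \<and> 0 \<in> A \<and> (\<forall>x\<in>A. \<forall>y\<in>A. x + y \<in> A)"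

lemma additive_subgroupD:
  assumes "additive_subgroup A"
  shows "A \<subseteq> F" "finite A" "0 \<in> A" "x \<in> A \<Longrightarrow> y \<in> A \<Longrightarrow> x + y \<in> A"
  using assms finite_F by (auto simp: additive_subgroup_def intro: finite_subset)

text \<open>The additive group of \<open>F\<close> is elementary abelian, so adjoining an element to a proper subgroup doubles
  its order.\<close>

lemma exists_additive_subgroup:
  assumes "2 ^ r \<le> card F"
  shows "\<exists>A. additive_subgroup A \<and> card A = 2 ^ r"
  using assms
proof (induction r)
  case 0
  have "additive_subgroup {0}" by (simp add: additive_subgroup_def zero_F)
  then show ?case by (intro exI[of _ "{0}"]) simp
next
  case (Suc r)
  then obtain A where A: "additive_subgroup A" "card A = 2 ^ r" by auto
  note AD = additive_subgroupD[OF A(1)]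
  have "card A < card F"
    using Suc.prems A(2) by (metis le_neq_implies_less lessI less_le_trans power_strict_increasing_iff
        one_less_numeral_iff semiring_norm(76))
  then obtain x where x: "x \<in> F" "x \<notin> A"
    using AD(1) by (metis less_irrefl subset_antisym subsetI)
  have disj: "A \<inter> (+) x ` A = {}"
  proof -
    have "False" if "a \<in> A" "x + a \<in> A" for a
      using AD(4)[OF that(2,1)] x(2) by (simp add: cancel_right)
    then show ?thesis by blast
  qed
  have "additive_subgroup (A \<union> (+) x ` A)"
  proof -
    have "u + v \<in> A \<union> (+) x ` A" if "u \<in> A \<union> (+) x ` A" "v \<in> A \<union> (+) x ` A" for u v
    proof -
      note uv = that
      have "x + a + (x + b) = (x + x) + (a + b)" for a b by (simp only: add_ac)
      then have eq: "x + a + (x + b) = a + b" for a b by (simp only: double add_0)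
      consider "u \<in> A" "v \<in> A" | b where "u \<in> A" "b \<in> A" "v = x + b"
        | a where "a \<in> A" "v \<in> A" "u = x + a"
        | a b where "a \<in> A" "b \<in> A" "u = x + a" "v = x + b"
        using uv by blast
      then show ?thesis
      proof cases
        case (2 b)
        then show ?thesis using AD(4) by (simp add: add.left_commute[of u x])
      next
        case (4 a b)
        then show ?thesis unfolding 4(3,4) eq using AD(4) by simp
      qed (use AD(4) in \<open>simp_all add: add.assoc\<close>)
    qed
    then show ?thesis
      using AD(1,3) x(1) by (auto simp: additive_subgroup_def intro: add_F)
  qed
  moreover have "card (A \<union> (+) x ` A) = 2 ^ Suc r"
    using AD(2) disj A(2) by (simp add: card_Un_disjoint card_image)
  ultimately show ?case by blast
qed

text \<open>There is only one coset of \<open>J\<close> besides \<open>J\<close> itself, and a coset is its own negative.\<close>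

lemma index_two_sum:
  assumes J: "additive_subgroup J" "2 * card J = card F"
    and xy: "x \<in> F - J" "y \<in> F - J"
  shows "x + y \<in> J"
proof -
  note JD = additive_subgroupD[OF J(1)]
  have "(+) x ` J \<subseteq> F - J"
  proof -
    have "False" if "a \<in> J" "x + a \<in> J" for a
      using JD(4)[OF that(2,1)] xy(1) by (simp add: cancel_right)
    then show ?thesis using JD(1) xy(1) by (auto intro: add_F)
  qed
  moreover have "card ((+) x ` J) = card (F - J)"
    using J(2) JD(1,2) by (simp add: card_image card_Diff_subset)
  ultimately have "(+) x ` J = F - J"
    using finite_F by (intro card_subset_eq) auto
  then obtain j where "j \<in> J" "y = x + j" using xy(2) by auto
  then show ?thesis by (simp add: cancel_left)
qed

text \<open>Translation by \<open>x\<close> exchanges the elements of \<open>A\<close> inside \<open>J\<close> with those outside.\<close>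

lemma card_Int_index_two:
  assumes J: "additive_subgroup J" "2 * card J = card F"
    and A: "additive_subgroup A" and x: "x \<in> A" "x \<notin> J"
  shows "2 * card (A \<inter> J) = card A"
proof -
  note JD = additive_subgroupD[OF J(1)] and AD = additive_subgroupD[OF A]
  have xF: "x \<in> F - J" using AD(1) x by auto
  have "bij_betw ((+) x) (A \<inter> J) (A - J)"
  proof (rule bij_betw_byWitness[where f' = "(+) x"])
    have "False" if "a \<in> J" "x + a \<in> J" for a
      using JD(4)[OF that(2,1)] x(2) by (simp add: cancel_right)
    then show "(+) x ` (A \<inter> J) \<subseteq> A - J" using AD(4) x(1) by auto
    show "(+) x ` (A - J) \<subseteq> A \<inter> J"
      using AD(1,4) x(1) index_two_sum[OF J xF] by auto
  qed (auto simp: cancel_left)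
  then have "card (A \<inter> J) = card (A - J)" by (rule bij_betw_same_card)
  moreover have "card A = card (A \<inter> J) + card (A - J)"
    using card_Int_Diff[OF AD(2)] .
  ultimately show ?thesis by simp
qed

text \<open>For \<open>T, N \<noteq> 0\<close> this is a hyperplane of \<open>F\<close> over the prime field. In particular \<open>quad_image 1 1\<close> is the
  set of elements of absolute trace zero. It has two uses: an element outside it makes the
  quadratic form anisotropic, and membership in it defines the twist of the nonabelian group.\<close>

definition quad_image :: "'a \<Rightarrow> 'a \<Rightarrow> 'a set" where
  "quad_image T N = (\<lambda>t. t * T + t\<^sup>2 * N) ` F"

lemma additive_subgroup_quad_image:
  assumes "T \<in> F" "N \<in> F"
  shows "additive_subgroup (quad_image T N)"
proof -
  let ?f = "\<lambda>t. t * T + t\<^sup>2 * N"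
  have add: "?f s + ?f t = ?f (s + t)" for s t
    by (simp add: square_add algebra_simps)
  have "u + v \<in> ?f ` F" if "u \<in> ?f ` F" "v \<in> ?f ` F" for u v
    using that by (auto simp only: add image_iff intro: add_F)
  moreover have "0 \<in> ?f ` F" by (rule image_eqI[of _ _ 0]) (simp_all add: zero_F)
  moreover have "?f ` F \<subseteq> F" using assms by (auto intro: closed_F)
  ultimately show ?thesis
    unfolding additive_subgroup_def quad_image_def by blast
qed

text \<open>The map is additive with kernel \<open>{0, T / N}\<close>, so it is two-to-one onto its image.\<close>

lemma card_quad_preimage:
  assumes "T \<in> F" "N \<in> F" "T \<noteq> 0" "N \<noteq> 0" and S: "S \<subseteq> quad_image T N"
  shows "card {t \<in> F. t * T + t\<^sup>2 * N \<in> S} = 2 * card S"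
proof -
  let ?f = "\<lambda>t. t * T + t\<^sup>2 * N"
  have fib: "card {t \<in> F. ?f t = s} = 2" if "s \<in> S" for s
  proof -
    obtain u where u: "u \<in> F" "s = ?f u" using S \<open>s \<in> S\<close> by (auto simp: quad_image_def)
    have "?f t = ?f u \<longleftrightarrow> t = u \<or> t = u + T / N" for t
    proof -
      have "?f t + ?f u = (t + u) * (T + (t + u) * N)"
        by (simp add: power2_eq_square algebra_simps double cancel_left)
      then have "?f t = ?f u \<longleftrightarrow> t + u = 0 \<or> T + (t + u) * N = 0"
        using eq_iff_sum_zero[of "?f t" "?f u"] by simp
      also have "T + (t + u) * N = 0 \<longleftrightarrow> t + u = T / N"
        using \<open>N \<noteq> 0\<close> by (simp add: eq_iff_sum_zero field_simps) (auto simp: algebra_simps)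
      also have "t + u = T / N \<longleftrightarrow> t = u + T / N"
        by (metis add.commute cancel_left)
      finally show ?thesis by (simp add: eq_iff_sum_zero)
    qed
    then have "{t \<in> F. ?f t = s} = {u, u + T / N}"
      using u assms by (auto intro: closed_F)
    moreover have "u \<noteq> u + T / N" using assms by simp
    ultimately show ?thesis by simp
  qed
  have "finite S" using S finite_F by (auto simp: quad_image_def intro: finite_subset)
  have "{t \<in> F. ?f t \<in> S} = (\<Union>s\<in>S. {t \<in> F. ?f t = s})" by auto
  also have "card \<dots> = (\<Sum>s\<in>S. card {t \<in> F. ?f t = s})"
    using \<open>finite S\<close> finite_F by (intro card_UN_disjoint) auto
  also have "\<dots> = 2 * card S" using fib by simp
  finally show ?thesis .
qed

lemma card_quad_image:
  assumes "T \<in> F" "N \<in> F" "T \<noteq> 0" "N \<noteq> 0"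
  shows "2 * card (quad_image T N) = card F"
proof -
  have "{t \<in> F. t * T + t\<^sup>2 * N \<in> quad_image T N} = F" by (auto simp: quad_image_def)
  then show ?thesis using card_quad_preimage[OF assms order_refl] by simp
qed

end

section \<open>Maximal arcs\<close>

locale maximal_arc = binary_subfield +
  fixes \<beta> :: "'a" and A :: "'a set"
  assumes \<beta>: "\<beta> \<in> F" "\<beta> \<notin> quad_image 1 1"
    and A: "additive_subgroup A"
begin

lemmas AD = additive_subgroupD[OF A]

definition Q :: "'a \<Rightarrow> 'a \<Rightarrow> 'a" where
  "Q x y = x\<^sup>2 + x * y + \<beta> * y\<^sup>2"

lemma Q_in_F: "x \<in> F \<Longrightarrow> y \<in> F \<Longrightarrow> Q x y \<in> F"
  by (simp add: Q_def closed_F \<beta>)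

lemma anisotropic:
  assumes "x \<in> F" "y \<in> F" "Q x y = 0"
  shows "x = 0 \<and> y = 0"
proof -
  have "y = 0"
  proof (rule ccontr)
    assume y: "y \<noteq> 0"
    have "(x / y) * 1 + (x / y)\<^sup>2 * 1 + \<beta> = Q x y / y\<^sup>2"
      using y by (simp add: Q_def field_simps power2_eq_square)
    then have "(x / y) * 1 + (x / y)\<^sup>2 * 1 = \<beta>"
      using assms(3) by (simp add: eq_iff_sum_zero)
    moreover have "x / y \<in> F" using assms by (simp add: closed_F)
    ultimately show False using \<beta>(2) by (auto simp: quad_image_def)
  qed
  then show ?thesis using assms(3) by (simp add: Q_def)
qed

lemma Q_line:
  "Q (x + t * a) (y + t * b) = Q x y + (t * (x * b + a * y) + t\<^sup>2 * Q a b)"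
proof -
  have "Q (x + t * a) (y + t * b) =
      Q x y + (t * (x * b + a * y) + t\<^sup>2 * Q a b) + (x * t * a + x * t * a) + \<beta> * (y * t * b + y * t * b)"
    by (simp add: Q_def power2_eq_square algebra_simps)
  then show ?thesis by (simp add: double)
qed

text \<open>\<open>Q\<close> is the norm form of the quadratic extension of \<open>F\<close> by a root \<open>\<omega>\<close> of \<open>X\<^sup>2 + X + \<beta>\<close>, and the substitution
  is the conjugation \<open>\<omega> \<mapsto> \<omega> + 1\<close> of this extension.\<close>

lemma Q_swap: "Q (x + y) y = Q x y"
proof -
  have "Q (x + y) y = Q x y + (x * y + x * y) + (y * y + y * y) - x * y + x * y"
    by (simp add: Q_def power2_eq_square algebra_simps)
  then show ?thesis by (simp add: double)
qed

definition K :: "('a \<times> 'a) set" where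
  "K = {(x, y). x \<in> F \<and> y \<in> F \<and> Q x y \<in> A}"

lemma finite_K: "finite K"
proof (rule finite_subset)
  show "K \<subseteq> F \<times> F" by (auto simp: K_def)
qed (simp add: finite_F)

lemma zero_in_K: "(0, 0) \<in> K"
  using AD(3) by (simp add: K_def Q_def zero_F)

text \<open>The maximal arc property. With \<open>T\<close> the polar form of the two vectors and \<open>N = Q a b\<close>, the points to
  be counted are the \<open>t\<close> with \<open>t T + t\<^sup>2 N \<in> A\<close>.\<close>

lemma line_meets_K:
  assumes xy: "(x, y) \<in> K" and ab: "a \<in> F" "b \<in> F" "a \<noteq> 0 \<or> b \<noteq> 0"
  shows "card {t \<in> F. (x + t * a, y + t * b) \<in> K} = card A"
proof -
  define T where "T = x * b + a * y"
  define N where "N = Q a b"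
  have F: "x \<in> F" "y \<in> F" and Qxy: "Q x y \<in> A" using xy by (auto simp: K_def)
  have T: "T \<in> F" and N: "N \<in> F" "N \<noteq> 0"
    using F ab anisotropic[of a b] by (auto simp: T_def N_def closed_F Q_in_F)
  have in_A: "Q x y + u \<in> A \<longleftrightarrow> u \<in> A" for u
    using AD(4)[OF Qxy] by (metis cancel_left)
  have set_eq: "{t \<in> F. (x + t * a, y + t * b) \<in> K} = {t \<in> F. t * T + t\<^sup>2 * N \<in> A}"
    using F ab by (auto simp: K_def closed_F Q_line in_A T_def N_def)
  show ?thesis
  proof (cases "T = 0")
    case True
    \<comment> \<open>Squaring is injective in characteristic two, so the map permutes \<open>F\<close>.\<close>
    have inj: "inj_on (\<lambda>t. t\<^sup>2 * N) F"
    proof (rule inj_onI)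
      fix s t assume "s\<^sup>2 * N = t\<^sup>2 * N"
      then have "(s + t)\<^sup>2 = 0" using N by (simp add: square_add two_eq_zero)
      then show "s = t" by (simp add: eq_iff_sum_zero)
    qed
    have "(\<lambda>t. t\<^sup>2 * N) ` F = F"
      using N by (intro endo_inj_surj[OF finite_F _ inj]) (auto intro: closed_F)
    then have "(\<lambda>t. t\<^sup>2 * N) ` {t \<in> F. t\<^sup>2 * N \<in> A} = A" using AD(1) by auto
    moreover have "inj_on (\<lambda>t. t\<^sup>2 * N) {t \<in> F. t\<^sup>2 * N \<in> A}"
      using inj by (rule inj_on_subset) auto
    ultimately have "card {t \<in> F. t\<^sup>2 * N \<in> A} = card A" using card_image by fastforce
    then show ?thesis unfolding set_eq using True by simp
  next
    case False
    \<comment> \<open>Otherwise the line would pass through a zero of \<open>Q\<close>, that is, through the origin, and then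
      the point would be a multiple of the direction and \<open>T\<close> would vanish.\<close>
    have "Q x y \<notin> quad_image T N"
    proof
      assume "Q x y \<in> quad_image T N"
      then obtain t where t: "t \<in> F" "Q x y = t * T + t\<^sup>2 * N" by (auto simp: quad_image_def)
      then have "Q (x + t * a) (y + t * b) = 0"
        by (simp add: Q_line double flip: T_def N_def)
      then have "x + t * a = 0" "y + t * b = 0"
        using anisotropic[of "x + t * a" "y + t * b"] F ab t(1) by (simp_all add: closed_F)
      then have "x = t * a" "y = t * b" by (simp_all add: eq_iff_sum_zero)
      then show False using False by (simp add: T_def double algebra_simps)
    qed
    note half = card_Int_index_two[OF additive_subgroup_quad_image[OF T N(1)]
        card_quad_image[OF T N(1) False N(2)] A Qxy this]
    have "{t \<in> F. t * T + t\<^sup>2 * N \<in> A} = {t \<in> F. t * T + t\<^sup>2 * N \<in> A \<inter> quad_image T N}"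
      by (auto simp: quad_image_def)
    then show ?thesis
      unfolding set_eq using half card_quad_preimage[OF T N(1) False N(2), of "A \<inter> quad_image T N"]
      by simp
  qed
qed

text \<open>Each of the \<open>card F + 1\<close> lines through the origin carries \<open>card A - 1\<close> points of \<open>K\<close> besides the origin.
  The line \<open>x = 0\<close> is treated separately, together with the origin; the others have a slope \<open>s\<close>.\<close>

lemma card_K: "card K = card A + card F * (card A - 1)"
proof -
  let ?L = "{0 :: 'a} \<times> {t \<in> F. (0, t) \<in> K}"
  let ?M = "SIGMA s:F. {t \<in> F - {0}. (t, t * s) \<in> K}"
  have "bij_betw (\<lambda>(s, t). (t, t * s)) ?M (K - ?L)"
  proof (rule bij_betw_byWitness[where f' = "\<lambda>(x, y). (y / x, x)"])
    show "(\<lambda>(x, y). (y / x, x)) ` (K - ?L) \<subseteq> ?M"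
      by (auto simp: K_def closed_F)
  qed (auto simp: K_def split: if_splits)
  then have "card (K - ?L) = card ?M" by (rule bij_betw_same_card[symmetric])
  also have "\<dots> = (\<Sum>s\<in>F. card {t \<in> F - {0}. (t, t * s) \<in> K})"
    using finite_F by (intro card_SigmaI) auto
  also have "\<dots> = (\<Sum>s\<in>F. card A - 1)"
  proof (rule sum.cong[OF refl])
    fix s assume s: "s \<in> F"
    have "{t \<in> F - {0}. (t, t * s) \<in> K} = {t \<in> F. (0 + t * 1, 0 + t * s) \<in> K} - {0}"
      by auto
    also have "card \<dots> = card {t \<in> F. (0 + t * 1, 0 + t * s) \<in> K} - 1"
      using zero_in_K zero_F by (intro card_Diff_singleton) auto
    also have "\<dots> = card A - 1"
      using line_meets_K[OF zero_in_K one_F s] by simp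
    finally show "card {t \<in> F - {0}. (t, t * s) \<in> K} = card A - 1" .
  qed
  finally have 1: "card (K - ?L) = card F * (card A - 1)" by simp
  have "card ?L = card A"
    using line_meets_K[OF zero_in_K zero_F one_F] by (simp add: card_cartesian_product)
  moreover have "card K = card ?L + card (K - ?L)"
  proof -
    have "?L \<subseteq> K" by auto
    then have "K \<inter> ?L = ?L" by blast
    with card_Int_Diff[OF finite_K, of ?L] show ?thesis by simp
  qed
  ultimately show ?thesis using 1 by simp
qed

end

section \<open>Translates of the cone over the arc\<close>

context maximal_arc begin

text \<open>The nonzero vectors whose projective point \<open>(1, x / z, y / z)\<close> lies on the arc.\<close>

definition D :: "('a \<times> 'a \<times> 'a) set" where
  "D = {(z, x, y). z \<in> F \<and> x \<in> F \<and> y \<in> F \<and> z \<noteq> 0 \<and> (x / z, y / z) \<in> K}"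

lemma D_param: "bij_betw (\<lambda>((a, b), u). (u, u * a, u * b)) (K \<times> (F - {0})) D"
  by (rule bij_betw_byWitness[where f' = "\<lambda>(z, x, y). ((x / z, y / z), z)"])
    (auto simp: D_def K_def closed_F)

lemma card_D: "card D = card K * (card F - 1)"
  using bij_betw_same_card[OF D_param] finite_F zero_F by (simp add: card_cartesian_product)

text \<open>Here \<open>g\<close> lies on the line spanned by \<open>(1, a, b)\<close>, and only \<open>d = 0\<close> and \<open>d = g\<close> fail.\<close>

lemma translate_on_line:
  assumes "z \<in> F" "z \<noteq> 0" "(a, b) \<in> K"
  shows "card {u \<in> F - {0}. (z + u, z * a + u * a, z * b + u * b) \<in> D} = card F - 2"
proof -
  have "{u \<in> F - {0}. (z + u, z * a + u * a, z * b + u * b) \<in> D} = F - {0, z}"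
  proof -
    have "(z + u, z * a + u * a, z * b + u * b) \<in> D" if "u \<in> F" "u \<noteq> z" for u
    proof -
      have nz: "z + u \<noteq> 0" using that by (simp add: eq_iff_sum_zero)
      have "z * a + u * a = (z + u) * a" "z * b + u * b = (z + u) * b"
        by (simp_all add: algebra_simps)
      then show ?thesis using nz assms that by (auto simp: D_def K_def closed_F)
    qed
    moreover have "(z + z, w) \<notin> D" for w by (auto simp: D_def double)
    ultimately show ?thesis by auto
  qed
  moreover have "card (F - {0, z}) = card F - 2"
    using assms zero_F finite_F by (subst card_Diff_subset) auto
  ultimately show ?thesis by simp
qed

text \<open>The vector \<open>g + u (1, a, b)\<close> has projective point \<open>(a, b) + t (p, q)\<close> with \<open>t = 1 / (z + u)\<close>, where \<open>(p, q)\<close>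
  is a fixed nonzero direction. As \<open>u\<close> varies this runs through the line in the direction \<open>(p, q)\<close>
  without its point \<open>(a, b)\<close>, so the maximal arc property leaves \<open>card A - 1\<close> values. One of them
  is \<open>u = 0\<close> precisely if \<open>g \<in> D\<close>.\<close>

lemma translate_off_line:
  assumes F: "z \<in> F" "x \<in> F" "y \<in> F" and ab: "(a, b) \<in> K"
    and off: "x \<noteq> z * a \<or> y \<noteq> z * b"
  shows "card {u \<in> F - {0}. (z + u, x + u * a, y + u * b) \<in> D} =
    (if (z, x, y) \<in> D then card A - 2 else card A - 1)"
proof -
  define p where "p = x + z * a"
  define q where "q = y + z * b"
  have abF: "a \<in> F" "b \<in> F" using ab by (auto simp: K_def)
  have pq: "p \<in> F" "q \<in> F" "p \<noteq> 0 \<or> q \<noteq> 0"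
    using F abF off by (auto simp: p_def q_def closed_F eq_iff_sum_zero)
  let ?P = "{u \<in> F. (z + u, x + u * a, y + u * b) \<in> D}"
  let ?L = "{t \<in> F. (a + t * p, b + t * q) \<in> K}"
  have key: "(z + u, x + u * a, y + u * b) \<in> D \<longleftrightarrow>
      z + u \<noteq> 0 \<and> (a + inverse (z + u) * p, b + inverse (z + u) * q) \<in> K" if "u \<in> F" for u
  proof (cases "z + u = 0")
    case False
    have num: "x + u * a = (z + u) * a + p" "y + u * b = (z + u) * b + q"
      unfolding p_def q_def by (simp_all add: algebra_simps two_eq_zero)
    have "(x + u * a) / (z + u) = a + inverse (z + u) * p"
      "(y + u * b) / (z + u) = b + inverse (z + u) * q"
      unfolding num using False by (simp_all add: field_simps)
    then show ?thesis using False F abF that by (auto simp: D_def closed_F)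
  qed (simp add: D_def)
  have "bij_betw (\<lambda>u. inverse (z + u)) ?P (?L - {0})"
  proof (rule bij_betw_byWitness[where f' = "\<lambda>t. z + inverse t"])
    show "(\<lambda>u. inverse (z + u)) ` ?P \<subseteq> ?L - {0}"
      using F by (auto simp: key closed_F)
    show "(\<lambda>t. z + inverse t) ` (?L - {0}) \<subseteq> ?P"
    proof
      fix u assume "u \<in> (\<lambda>t. z + inverse t) ` (?L - {0})"
      then obtain t where t: "t \<in> ?L" "t \<noteq> 0" "u = z + inverse t" by auto
      then have "u \<in> F" "z + u = inverse t" using F by (simp_all add: closed_F cancel_left)
      then show "u \<in> ?P" using t(1,2) key[of u] by simp
    qed
  qed (auto simp: cancel_left)
  then have "card ?P = card (?L - {0})" by (rule bij_betw_same_card)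
  also have "\<dots> = card A - 1"
    using line_meets_K[OF ab pq] ab zero_F by (subst card_Diff_singleton) auto
  finally have P: "card ?P = card A - 1" .
  have "{u \<in> F - {0}. (z + u, x + u * a, y + u * b) \<in> D} = ?P - {0}" by auto
  moreover have "0 \<in> ?P \<longleftrightarrow> (z, x, y) \<in> D" by (simp add: zero_F)
  ultimately show ?thesis using P by (simp add: card_Diff_singleton_if numeral_2_eq_2)
qed

text \<open>A vector \<open>g \<in> D\<close> lies on the line of exactly one \<open>\<kappa> \<in> K\<close>, and a nonzero \<open>g \<notin> D\<close> on none.\<close>

lemma card_translate:
  assumes F: "z \<in> F" "x \<in> F" "y \<in> F" and nz: "(z, x, y) \<noteq> (0, 0, 0)"
  shows "card {(u, v, w) \<in> D. (z + u, x + v, y + w) \<in> D} =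
    (if (z, x, y) \<in> D then card F - 2 + (card K - 1) * (card A - 2) else card K * (card A - 1))"
proof -
  let ?fib = "\<lambda>(a, b). {u \<in> F - {0}. (z + u, x + u * a, y + u * b) \<in> D}"
  let ?on = "\<lambda>(a, b). x = z * a \<and> y = z * b"
  let ?off = "if (z, x, y) \<in> D then card A - 2 else card A - 1"
  have "bij_betw (\<lambda>((a, b), u). (u, u * a, u * b)) (Sigma K ?fib)
      {(u, v, w) \<in> D. (z + u, x + v, y + w) \<in> D}"
    by (rule bij_betw_byWitness[where f' = "\<lambda>(z, x, y). ((x / z, y / z), z)"])
      (auto simp: D_def K_def closed_F)
  then have "card {(u, v, w) \<in> D. (z + u, x + v, y + w) \<in> D} = card (Sigma K ?fib)"
    by (simp add: bij_betw_same_card)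
  also have "\<dots> = (\<Sum>\<kappa>\<in>K. card (?fib \<kappa>))"
    using finite_K finite_F by (intro card_SigmaI) auto
  finally have sum: "card {(u, v, w) \<in> D. (z + u, x + v, y + w) \<in> D} = (\<Sum>\<kappa>\<in>K. card (?fib \<kappa>))" .
  have off: "card (?fib \<kappa>) = ?off" if "\<kappa> \<in> K" "\<not> ?on \<kappa>" for \<kappa>
    using that translate_off_line[OF F] by (cases \<kappa>) auto
  show ?thesis
  proof (cases "(z, x, y) \<in> D")
    case True
    let ?c = "(x / z, y / z)"
    have c: "?c \<in> K" "z \<noteq> 0" "?on ?c" using True by (auto simp: D_def)
    have "?on \<kappa> \<Longrightarrow> \<kappa> = ?c" for \<kappa> using c(2) by (cases \<kappa>) auto
    then have "card (?fib \<kappa>) = card A - 2" if "\<kappa> \<in> K - {?c}" for \<kappa>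
      using off[of \<kappa>] that True by auto
    then have "(\<Sum>\<kappa>\<in>K - {?c}. card (?fib \<kappa>)) = (card K - 1) * (card A - 2)"
      using c(1) finite_K by simp
    moreover have "card (?fib ?c) = card F - 2"
      using translate_on_line[OF F(1) c(2,1)] c(2) by simp
    ultimately show ?thesis
      unfolding sum using True by (simp add: sum.remove[OF finite_K c(1)])
  next
    case False
    have "\<not> ?on \<kappa>" if "\<kappa> \<in> K" for \<kappa>
    proof
      assume on: "?on \<kappa>"
      obtain a b where [simp]: "\<kappa> = (a, b)" by (cases \<kappa>)
      have "z \<noteq> 0" using on nz by auto
      then have "(z, x, y) \<in> D" using on F that by (auto simp: D_def)
      with False show False by blast
    qed
    then show ?thesis unfolding sum using off False by simp
  qed
qed

end

section \<open>Differences in groups\<close>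

text \<open>A representation \<open>g = d1 d2\<^sup>-\<^sup>1\<close> is determined by \<open>d2\<close>, and then \<open>d1 = g d2\<close>. This turns the defining
  condition into a count of the points of \<open>D\<close> that left translation by \<open>g\<close> keeps in \<open>D\<close>.\<close>

lemma (in group) card_quotient_representations:
  assumes D: "D \<subseteq> carrier G" and g: "g \<in> carrier G"
  shows "card {(d1, d2). d1 \<in> D \<and> d2 \<in> D \<and> g = d1 \<otimes> inv d2} = card {d \<in> D. g \<otimes> d \<in> D}"
proof -
  have "bij_betw snd {(d1, d2). d1 \<in> D \<and> d2 \<in> D \<and> g = d1 \<otimes> inv d2} {d \<in> D. g \<otimes> d \<in> D}"
    by (rule bij_betw_byWitness[where f' = "\<lambda>d. (g \<otimes> d, d)"])
      (use D g in \<open>auto simp: m_assoc subset_iff\<close>)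
  then show ?thesis by (rule bij_betw_same_card)
qed

lemma partial_difference_set_iso:
  assumes PDS: "partial_difference_set G D v k l u" and H: "group H" and h: "h \<in> iso G H"
  shows "partial_difference_set H (h ` D) v k l u"
proof -
  from PDS have G: "group G" and fin: "finite (carrier G)" and D: "D \<subseteq> carrier G"
    and v: "Coset.order G = v" and k: "card D = k"
    and l: "\<And>g. g \<in> D - {\<one>\<^bsub>G\<^esub>} \<Longrightarrow>
      card {(d1, d2). d1 \<in> D \<and> d2 \<in> D \<and> g = d1 \<otimes>\<^bsub>G\<^esub> inv\<^bsub>G\<^esub> d2} = l"
    and u: "\<And>g. g \<in> carrier G - (D \<union> {\<one>\<^bsub>G\<^esub>}) \<Longrightarrow>
      card {(d1, d2). d1 \<in> D \<and> d2 \<in> D \<and> g = d1 \<otimes>\<^bsub>G\<^esub> inv\<^bsub>G\<^esub> d2} = u"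
    unfolding partial_difference_set_def by auto
  interpret G: group G by (rule G)
  interpret H: group H by (rule H)
  interpret h: group_hom G H h
    using h by unfold_locales (simp add: iso_def)
  have inj: "inj_on h (carrier G)" and im: "h ` carrier G = carrier H"
    using h by (auto simp: iso_def bij_betw_def)
  have mem: "h g \<in> h ` D \<longleftrightarrow> g \<in> D" if "g \<in> carrier G" for g
    using inj_on_image_mem_iff[OF inj that D] .
  have count: "card {(e1, e2). e1 \<in> h ` D \<and> e2 \<in> h ` D \<and> h g = e1 \<otimes>\<^bsub>H\<^esub> inv\<^bsub>H\<^esub> e2} =
      card {(d1, d2). d1 \<in> D \<and> d2 \<in> D \<and> g = d1 \<otimes>\<^bsub>G\<^esub> inv\<^bsub>G\<^esub> d2}" if g: "g \<in> carrier G" for g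
  proof -
    have "{e \<in> h ` D. h g \<otimes>\<^bsub>H\<^esub> e \<in> h ` D} = h ` {d \<in> D. g \<otimes>\<^bsub>G\<^esub> d \<in> D}"
    proof -
      have "h g \<otimes>\<^bsub>H\<^esub> h d \<in> h ` D \<longleftrightarrow> g \<otimes>\<^bsub>G\<^esub> d \<in> D" if "d \<in> D" for d
      proof -
        have "d \<in> carrier G" using that D by blast
        then show ?thesis using mem[of "g \<otimes>\<^bsub>G\<^esub> d"] g by simp
      qed
      then show ?thesis by auto
    qed
    moreover have "inj_on h {d \<in> D. g \<otimes>\<^bsub>G\<^esub> d \<in> D}"
      using inj by (rule inj_on_subset) (use D in auto)
    moreover have "h ` D \<subseteq> carrier H" "h g \<in> carrier H" using D g im by auto
    ultimately show ?thesis
      using G.card_quotient_representations[OF D g] H.card_quotient_representations[of "h ` D" "h g"]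
      by (simp add: card_image)
  qed
  have one: "\<one>\<^bsub>H\<^esub> = h \<one>\<^bsub>G\<^esub>" by simp
  have hD: "h ` D - {\<one>\<^bsub>H\<^esub>} = h ` (D - {\<one>\<^bsub>G\<^esub>})"
    unfolding one using D by (subst inj_on_image_set_diff[OF inj]) auto
  have hC: "carrier H - (h ` D \<union> {\<one>\<^bsub>H\<^esub>}) = h ` (carrier G - (D \<union> {\<one>\<^bsub>G\<^esub>}))"
    unfolding one using inj D im
    by (subst inj_on_image_set_diff[OF inj]) auto
  have "finite (carrier H)" unfolding im[symmetric] using fin by simp
  then show ?thesis
    unfolding partial_difference_set_def hD hC
  proof (intro conjI)
    show "Coset.order H = v"
      using v card_image[OF inj] by (simp add: Coset.order_def im)
    show "card (h ` D) = k"
      using k card_image[OF inj_on_subset[OF inj D]] by simp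
    show "\<forall>g\<in>h ` (D - {\<one>\<^bsub>G\<^esub>}).
        card {(d1, d2). d1 \<in> h ` D \<and> d2 \<in> h ` D \<and> g = d1 \<otimes>\<^bsub>H\<^esub> inv\<^bsub>H\<^esub> d2} = l"
      using count l D by blast
    show "\<forall>g\<in>h ` (carrier G - (D \<union> {\<one>\<^bsub>G\<^esub>})).
        card {(d1, d2). d1 \<in> h ` D \<and> d2 \<in> h ` D \<and> g = d1 \<otimes>\<^bsub>H\<^esub> inv\<^bsub>H\<^esub> d2} = u"
      using count u by blast
  qed (use H D im in auto)
qed

section \<open>The twisted group\<close>

context binary_subfield begin

definition twist :: "'a \<Rightarrow> 'a \<Rightarrow> 'a" where
  "twist z y = (if z \<in> quad_image 1 1 then 0 else y)"

text \<open>The semidirect product of \<open>F\<close> with \<open>F\<^sup>2\<close> in which \<open>z\<close> acts by \<open>(x, y) \<mapsto> (x + y, y)\<close> if it lies outside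
  \<open>quad_image 1 1\<close>, and trivially otherwise.\<close>

definition twisted_group :: "('a \<times> 'a \<times> 'a) monoid" where
  "twisted_group = \<lparr>carrier = F \<times> F \<times> F,
     monoid.mult = (\<lambda>(z, x, y) (z', x', y'). (z + z', x + x' + twist z y', y + y')),
     monoid.one = (0, 0, 0)\<rparr>"

lemma twist_F: "y \<in> F \<Longrightarrow> twist z y \<in> F"
  by (simp add: twist_def zero_F)

lemma twist_add_right: "twist z (y + y') = twist z y + twist z y'"
  by (simp add: twist_def)

text \<open>The action is a homomorphism because \<open>quad_image 1 1\<close> has index two.\<close>

lemma twist_add_left:
  assumes "z \<in> F" "z' \<in> F"
  shows "twist (z + z') y = twist z y + twist z' y"
proof -
  let ?H = "quad_image 1 1"
  have H: "additive_subgroup ?H" "2 * card ?H = card F"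
    by (simp_all add: additive_subgroup_quad_image card_quad_image one_F)
  note HD = additive_subgroupD(4)[OF H(1)]
  have "z + z' \<in> ?H \<longleftrightarrow> (z \<in> ?H \<longleftrightarrow> z' \<in> ?H)"
    using HD[of z z'] HD[of z "z + z'"] HD[of "z + z'" z'] index_two_sum[OF H, of z z'] assms
    unfolding cancel_left cancel_right by blast
  then show ?thesis by (auto simp: twist_def double)
qed

lemma twist_zero: "twist 0 y = 0" "twist z 0 = 0"
proof -
  have "0 \<in> quad_image 1 1"
    using additive_subgroupD(3) additive_subgroup_quad_image[OF one_F one_F] by blast
  then show "twist 0 y = 0" "twist z 0 = 0" by (simp_all add: twist_def)
qed

lemma group_twisted_group: "group twisted_group"
proof (rule groupI)
  fix g g' g'' assume "g \<in> carrier twisted_group" "g' \<in> carrier twisted_group"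
  then show "g \<otimes>\<^bsub>twisted_group\<^esub> g' \<in> carrier twisted_group"
    by (auto simp: twisted_group_def closed_F twist_F)
  assume "g'' \<in> carrier twisted_group"
  with \<open>g \<in> _\<close> \<open>g' \<in> _\<close>
  show "g \<otimes>\<^bsub>twisted_group\<^esub> g' \<otimes>\<^bsub>twisted_group\<^esub> g'' = g \<otimes>\<^bsub>twisted_group\<^esub> (g' \<otimes>\<^bsub>twisted_group\<^esub> g'')"
    by (auto simp: twisted_group_def twist_add_left twist_add_right algebra_simps)
next
  fix g assume "g \<in> carrier twisted_group"
  then obtain z x y where g: "g = (z, x, y)" "z \<in> F" "x \<in> F" "y \<in> F"
    by (auto simp: twisted_group_def)
  show "\<exists>g'\<in>carrier twisted_group. g' \<otimes>\<^bsub>twisted_group\<^esub> g = \<one>\<^bsub>twisted_group\<^esub>"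
    by (rule bexI[of _ "(z, x + twist z y, y)"])
      (use g in \<open>simp_all add: twisted_group_def double closed_F twist_F add_ac cancel_left two_eq_zero\<close>)
qed (auto simp: twisted_group_def zero_F twist_zero)

lemma not_comm_twisted_group:
  assumes b: "b \<in> F" "b \<notin> quad_image 1 1"
  shows "\<not> comm_group twisted_group"
proof
  assume "comm_group twisted_group"
  then interpret comm_group twisted_group .
  have "(b, 0, 0) \<otimes>\<^bsub>twisted_group\<^esub> (0, 0, 1) = (0, 0, 1) \<otimes>\<^bsub>twisted_group\<^esub> (b, 0, 0)"
    by (rule m_comm) (simp_all add: twisted_group_def zero_F one_F b)
  then show False using b by (simp add: twisted_group_def twist_zero) (simp add: twist_def)
qed

end

context maximal_arc begin

lemma twist_D: "z \<in> F \<Longrightarrow> (u, v + twist z w, w) \<in> D \<longleftrightarrow> (u, v, w) \<in> D"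
proof (cases "w \<in> F")
  case True
  have iff: "b \<in> F \<Longrightarrow> a + b \<in> F \<longleftrightarrow> a \<in> F" for a b
    using add_F[of "a + b" b] add_F[of a b] by (auto simp: cancel_right)
  show ?thesis
    using True by (auto simp: D_def K_def twist_def Q_swap add_divide_distrib iff divide_F)
qed (simp add: D_def)

text \<open>Applying the action of \<open>z\<close> to \<open>d\<close> permutes \<open>D\<close> and turns left multiplication by \<open>(z, x, y)\<close> into
  addition of \<open>(z, x, y)\<close>.\<close>

lemma card_twisted_translate:
  assumes "z \<in> F" "x \<in> F" "y \<in> F"
  shows "card {d \<in> D. (z, x, y) \<otimes>\<^bsub>twisted_group\<^esub> d \<in> D} =
    card {(u, v, w) \<in> D. (z + u, x + v, y + w) \<in> D}"
proof -
  have 1: "v + twist z w + twist z w = v" for v w by (rule cancel_right)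
  have "bij_betw (\<lambda>(u, v, w). (u, v + twist z w, w))
      {d \<in> D. (z, x, y) \<otimes>\<^bsub>twisted_group\<^esub> d \<in> D} {(u, v, w) \<in> D. (z + u, x + v, y + w) \<in> D}"
    by (rule bij_betw_byWitness[where f' = "\<lambda>(u, v, w). (u, v + twist z w, w)"])
      (use assms in \<open>auto simp: twisted_group_def twist_D add.assoc 1 double\<close>)
  then show ?thesis by (rule bij_betw_same_card)
qed

lemma partial_difference_set_D:
  "partial_difference_set twisted_group D ((card F) ^ 3) (card K * (card F - 1))
    (card F - 2 + (card K - 1) * (card A - 2)) (card K * (card A - 1))"
proof -
  interpret group twisted_group by (rule group_twisted_group)
  have D: "D \<subseteq> carrier twisted_group" by (auto simp: D_def twisted_group_def)
  have count: "card {(d1, d2). d1 \<in> D \<and> d2 \<in> D \<and> g = d1 \<otimes>\<^bsub>twisted_group\<^esub> inv\<^bsub>twisted_group\<^esub> d2} =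
    (if g \<in> D then card F - 2 + (card K - 1) * (card A - 2) else card K * (card A - 1))"
    if "g \<in> carrier twisted_group" "g \<noteq> \<one>\<^bsub>twisted_group\<^esub>" for g
  proof -
    obtain z x y where g: "g = (z, x, y)" by (cases g)
    with that have F: "z \<in> F" "x \<in> F" "y \<in> F" and nz: "(z, x, y) \<noteq> (0, 0, 0)"
      by (auto simp: twisted_group_def)
    show ?thesis
      unfolding card_quotient_representations[OF D that(1)] unfolding g
      using card_twisted_translate[OF F] card_translate[OF F nz] by simp
  qed
  have "Coset.order twisted_group = card F ^ 3"
    by (simp add: Coset.order_def twisted_group_def card_cartesian_product power3_eq_cube)
  moreover have "finite (carrier twisted_group)"
    by (simp add: twisted_group_def finite_F)
  ultimately show ?thesis
    unfolding partial_difference_set_def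
  proof (intro conjI ballI)
    fix g assume "g \<in> D - {\<one>\<^bsub>twisted_group\<^esub>}"
    then have "g \<in> carrier twisted_group" "g \<noteq> \<one>\<^bsub>twisted_group\<^esub>" "g \<in> D" using D by auto
    then show "card {(d1, d2). d1 \<in> D \<and> d2 \<in> D \<and> g = d1 \<otimes>\<^bsub>twisted_group\<^esub> inv\<^bsub>twisted_group\<^esub> d2} =
        card F - 2 + (card K - 1) * (card A - 2)"
      using count by presburger
  next
    fix g assume "g \<in> carrier twisted_group - (D \<union> {\<one>\<^bsub>twisted_group\<^esub>})"
    then have "g \<in> carrier twisted_group" "g \<noteq> \<one>\<^bsub>twisted_group\<^esub>" "g \<notin> D" by auto
    then show "card {(d1, d2). d1 \<in> D \<and> d2 \<in> D \<and> g = d1 \<otimes>\<^bsub>twisted_group\<^esub> inv\<^bsub>twisted_group\<^esub> d2} =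
        card K * (card A - 1)"
      using count by presburger
  qed (use D card_D in auto)
qed

end

section \<open>The nonabelian group\<close>

lemma group_iso_nat:
  assumes "group G" "finite (carrier G)"
  shows "\<exists>(H :: nat monoid) h. group H \<and> h \<in> iso G H"
proof -
  interpret group G by fact
  obtain h :: "'a \<Rightarrow> nat" where h: "inj_on h (carrier G)"
    using finite_imp_inj_to_nat_seg[OF assms(2)] by blast
  define k where "k = inv_into (carrier G) h"
  have k: "k (h g) = g" if "g \<in> carrier G" for g
    using that h by (simp add: k_def)
  define H where "H = \<lparr>carrier = h ` carrier G, monoid.mult = (\<lambda>a b. h (k a \<otimes>\<^bsub>G\<^esub> k b)), monoid.one = h \<one>\<^bsub>G\<^esub>\<rparr>"
  have "group H"
  proof (rule groupI)
    fix a assume "a \<in> carrier H"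
    then obtain g where "g \<in> carrier G" "a = h g" by (auto simp: H_def)
    then show "\<exists>b\<in>carrier H. b \<otimes>\<^bsub>H\<^esub> a = \<one>\<^bsub>H\<^esub>"
      by (intro bexI[of _ "h (inv\<^bsub>G\<^esub> g)"]) (simp_all add: H_def k)
  qed (auto simp: H_def k m_assoc)
  moreover have "h \<in> iso G H"
    using h by (auto simp: iso_def hom_def bij_betw_def H_def k)
  ultimately show ?thesis by blast
qed

text \<open>Any \<open>\<beta>\<close> outside \<open>quad_image 1 1\<close> serves two purposes: it makes \<open>Q\<close> anisotropic, and it acts nontrivially,
  which makes the group nonabelian.\<close>

theorem theorem6p2:
  fixes m :: nat
  assumes "m \<ge> 2"
  shows "\<exists>G :: nat monoid. group G \<and> \<not> comm_group G \<and>
    (\<forall>r::nat. 1 \<le> r \<and> r < m \<longrightarrow>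
      (\<exists>D. partial_difference_set G D
        (2 ^ (3 * m))
        ((2 ^ (m + r) - 2 ^ m + 2 ^ r) * (2 ^ m - 1))
        (2 ^ m - 2 ^ r + (2 ^ (m + r) - 2 ^ m + 2 ^ r) * (2 ^ r - 2))
        ((2 ^ (m + r) - 2 ^ m + 2 ^ r) * (2 ^ r - 1))))"
proof -
  obtain F :: "bit alg_closure set" where F: "binary_subfield F" "card F = 2 ^ m"
    using exists_binary_subfield[of m] assms by auto
  interpret binary_subfield F by (rule F(1))
  let ?H = "quad_image 1 1"
  have "2 * card ?H = card F" by (rule card_quad_image) (simp_all add: one_F)
  moreover have "card F > 0" using F(2) by simp
  ultimately have "\<not> F \<subseteq> ?H"
    using additive_subgroupD(2)[OF additive_subgroup_quad_image[OF one_F one_F]]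
    by (metis card_mono leD mult_2 less_add_same_cancel1 zero_less_iff_neq_zero mult_is_0)
  then obtain \<beta> where \<beta>: "\<beta> \<in> F" "\<beta> \<notin> ?H" by auto
  have "finite (carrier twisted_group)"
    by (simp add: twisted_group_def finite_F)
  then obtain G :: "nat monoid" and h where G: "group G" "h \<in> iso twisted_group G"
    using group_iso_nat[OF group_twisted_group] by blast
  have "\<not> comm_group G"
  proof
    assume "comm_group G"
    moreover have "G \<cong> twisted_group"
      using G(2) group.iso_sym[OF group_twisted_group] by (auto simp: is_iso_def)
    ultimately have "comm_group twisted_group"
      using comm_group.iso_imp_comm_group group.is_monoid[OF group_twisted_group] by blast
    then show False using not_comm_twisted_group[OF \<beta>] by blast
  qed
  moreover have "\<exists>D. partial_difference_set G D (2 ^ (3 * m))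
        ((2 ^ (m + r) - 2 ^ m + 2 ^ r) * (2 ^ m - 1))
        (2 ^ m - 2 ^ r + (2 ^ (m + r) - 2 ^ m + 2 ^ r) * (2 ^ r - 2))
        ((2 ^ (m + r) - 2 ^ m + 2 ^ r) * (2 ^ r - 1))" if r: "1 \<le> r" "r < m" for r
  proof -
    have le: "(2::nat) ^ r \<le> 2 ^ m" "(2::nat) ^ 1 \<le> 2 ^ r"
      using r by (intro power_increasing; simp)+
    then obtain A where A': "additive_subgroup A" "card A = 2 ^ r"
      using exists_additive_subgroup F(2) by metis
    interpret maximal_arc F \<beta> A
      by unfold_locales (use \<beta> A' in auto)
    have K: "card K = 2 ^ (m + r) - 2 ^ m + 2 ^ r"
      unfolding card_K F(2) A'(2) by (simp add: power_add diff_mult_distrib2)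
    \<comment> \<open>Moving one direction from the product to the other summand, \<open>q - 2 + (k - 1) (n - 2)\<close> equals
      \<open>q - n + k (n - 2)\<close>; the witnesses make the truncated subtractions exact.\<close>
    obtain n' j where "(2::nat) ^ r = n' + 2" "(2::nat) ^ m = n' + 2 + j"
      using le by (metis add.commute le_Suc_ex power_one_right)
    moreover obtain k' where "card K = Suc k'"
      using K le by (metis add_gr_0 gr0_implies_Suc zero_less_numeral zero_less_power)
    ultimately have "card F - 2 + (card K - 1) * (card A - 2) =
        2 ^ m - 2 ^ r + card K * (2 ^ r - 2)"
      unfolding F(2) A'(2) by simp
    then have "partial_difference_set G (h ` D) (2 ^ (3 * m))
        (card K * (2 ^ m - 1)) (2 ^ m - 2 ^ r + card K * (2 ^ r - 2)) (card K * (2 ^ r - 1))"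
      using partial_difference_set_iso[OF partial_difference_set_D G]
      by (simp add: F(2) A'(2) mult.commute flip: power_mult)
    then show ?thesis unfolding K by blast
  qed
  ultimately show ?thesis using G(1) by blast
qed

end
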